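(* Let $G$ be a group with finitely many conjugacy classes of finite subgroups. Then $B_{0F}(G)$ is a finite abelian group.
   Context: For a group $G$, let $M_F(G)\le H_2(G,\mathbb Z)$ be the sum of the images of all maps $H_2(H,\mathbb Z)\to H_2(G,\mathbb Z)$ induced by inclusion, where $H$ runs through all finite subgroups of $G$, and let $M_{0F}(G)$ be the sum of the images of all maps $H_2(A,\mathbb Z)\to H_2(G,\mathbb Z)$ induced by inclusion, where $A$ runs through all finite abelian subgroups of $G$. The finitary Bogomolov multiplier of $G$ is $B_{0F}(G)=M_F(G)/M_{0F}(G)$. *)

theory Defs
  imports "HOL-Algebra.Free_Abelian_Groups" "HOL-Algebra.Group_Action"
begin

text \<open>Integral group homology is computed from the inhomogeneous (unnormalised) bar complex,
  that is, from the bar resolution after taking coinvariants of the trivial module \<open>\<int>\<close>.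
  Its degree \<open>n\<close> term is free abelian on the \<open>n\<close>-tuples of group elements, encoded as lists.\<close>

definition bar_chain_group :: "nat \<Rightarrow> ('a, 'b) monoid_scheme \<Rightarrow> ('a list \<Rightarrow>\<^sub>0 int) monoid"
  where "bar_chain_group n G =
    free_Abelian_group {xs. length xs = n \<and> set xs \<subseteq> carrier G}"

text \<open>Lists are indexed from 0: inner face \<open>i\<close> of \<open>[g\<^sub>1|\<dots>|g\<^sub>n]\<close> multiplies \<open>g\<^sub>i = xs ! (i - 1)\<close>
  and \<open>g\<^sub>i\<^sub>+\<^sub>1 = xs ! i\<close>.\<close>

definition bar_face :: "('a, 'b) monoid_scheme \<Rightarrow> nat \<Rightarrow> 'a list \<Rightarrow> 'a list"
  where "bar_face G i xs =
    (if i = 0 then tl xs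
     else if i = length xs then butlast xs
     else take (i - 1) xs @ [xs ! (i - 1) \<otimes>\<^bsub>G\<^esub> xs ! i] @ drop (i + 1) xs)"

definition bar_boundary :: "('a, 'b) monoid_scheme \<Rightarrow> ('a list \<Rightarrow>\<^sub>0 int) \<Rightarrow> ('a list \<Rightarrow>\<^sub>0 int)"
  where "bar_boundary G = frag_extend
    (\<lambda>xs. if xs = [] then 0
          else \<Sum>i\<le>length xs. frag_cmul ((-1) ^ i) (frag_of (bar_face G i xs)))"

definition bar_cycles :: "nat \<Rightarrow> ('a, 'b) monoid_scheme \<Rightarrow> ('a list \<Rightarrow>\<^sub>0 int) set"
  where "bar_cycles n G = {c \<in> carrier (bar_chain_group n G). bar_boundary G c = 0}"

definition bar_boundaries :: "nat \<Rightarrow> ('a, 'b) monoid_scheme \<Rightarrow> ('a list \<Rightarrow>\<^sub>0 int) set"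
  where "bar_boundaries n G = bar_boundary G ` carrier (bar_chain_group (Suc n) G)"

definition bar_cycle_group :: "nat \<Rightarrow> ('a, 'b) monoid_scheme \<Rightarrow> ('a list \<Rightarrow>\<^sub>0 int) monoid"
  where "bar_cycle_group n G = subgroup_generated (bar_chain_group n G) (bar_cycles n G)"

definition group_homology :: "nat \<Rightarrow> ('a, 'b) monoid_scheme \<Rightarrow> ('a list \<Rightarrow>\<^sub>0 int) set monoid"
  where "group_homology n G = bar_cycle_group n G Mod bar_boundaries n G"

definition bar_map :: "('a \<Rightarrow> 'c) \<Rightarrow> ('a list \<Rightarrow>\<^sub>0 int) \<Rightarrow> ('c list \<Rightarrow>\<^sub>0 int)"
  where "bar_map f = frag_extend (\<lambda>xs. frag_of (map f xs))"

text \<open>The map induced on homology by a homomorphism \<open>f\<close> into \<open>L\<close>.  A class is a coset \<open>X\<close> of the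
  boundaries, and its image is the coset of the boundaries of \<open>L\<close> containing the chainwise image
  of \<open>X\<close>; cf. \<open>group_homology_map_coset\<close> below.\<close>

definition group_homology_map ::
    "nat \<Rightarrow> ('c, 'd) monoid_scheme \<Rightarrow> ('a \<Rightarrow> 'c) \<Rightarrow> ('a list \<Rightarrow>\<^sub>0 int) set \<Rightarrow> ('c list \<Rightarrow>\<^sub>0 int) set"
  where "group_homology_map n L f X =
    set_mult (bar_cycle_group n L) (bar_boundaries n L) (bar_map f ` X)"

definition H2_image :: "('a, 'b) monoid_scheme \<Rightarrow> 'a set \<Rightarrow> ('a list \<Rightarrow>\<^sub>0 int) set set"
  where "H2_image G H =
    group_homology_map 2 G id ` carrier (group_homology 2 (G\<lparr>carrier := H\<rparr>))"

definition finite_subgroups :: "('a, 'b) monoid_scheme \<Rightarrow> 'a set set"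
  where "finite_subgroups G = {H. subgroup H G \<and> finite H}"

definition finite_abelian_subgroups :: "('a, 'b) monoid_scheme \<Rightarrow> 'a set set"
  where "finite_abelian_subgroups G = {A \<in> finite_subgroups G. comm_group (G\<lparr>carrier := A\<rparr>)}"

text \<open>A sum of subgroups of the abelian group \<open>H\<^sub>2(G, \<int>)\<close> is the subgroup generated by their union.\<close>

definition M\<^sub>F :: "('a, 'b) monoid_scheme \<Rightarrow> ('a list \<Rightarrow>\<^sub>0 int) set set"
  where "M\<^sub>F G = generate (group_homology 2 G) (\<Union>H\<in>finite_subgroups G. H2_image G H)"

definition M\<^sub>0\<^sub>F :: "('a, 'b) monoid_scheme \<Rightarrow> ('a list \<Rightarrow>\<^sub>0 int) set set"
  where "M\<^sub>0\<^sub>F G = generate (group_homology 2 G) (\<Union>A\<in>finite_abelian_subgroups G. H2_image G A)"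

definition finitary_Bogomolov_multiplier ::
    "('a, 'b) monoid_scheme \<Rightarrow> ('a list \<Rightarrow>\<^sub>0 int) set set monoid"
  where "finitary_Bogomolov_multiplier G = (group_homology 2 G)\<lparr>carrier := M\<^sub>F G\<rparr> Mod M\<^sub>0\<^sub>F G"

definition finite_subgroup_conjugacy_classes :: "('a, 'b) monoid_scheme \<Rightarrow> 'a set set set"
  where "finite_subgroup_conjugacy_classes G =
    orbits G (finite_subgroups G) (\<lambda>g H. g <#\<^bsub>G\<^esub> H #>\<^bsub>G\<^esub> inv\<^bsub>G\<^esub> g)"

subsection \<open>Sanity checks in degree 2\<close>

lemma bar_boundary_2:
  "bar_boundary G (frag_of [g, h]) = frag_of [h] - frag_of [g \<otimes>\<^bsub>G\<^esub> h] + frag_of [g]"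
  by (simp add: bar_boundary_def bar_face_def numeral_2_eq_2)

lemma bar_boundary_3:
  "bar_boundary G (frag_of [g, h, k]) =
    frag_of [h, k] - frag_of [g \<otimes>\<^bsub>G\<^esub> h, k] + frag_of [g, h \<otimes>\<^bsub>G\<^esub> k] - frag_of [g, h]"
  by (simp add: bar_boundary_def bar_face_def numeral_3_eq_3)

lemma bar_boundary_0 [simp]: "bar_boundary G 0 = 0"
  and bar_boundary_add: "bar_boundary G (a + b) = bar_boundary G a + bar_boundary G b"
  and bar_boundary_diff: "bar_boundary G (a - b) = bar_boundary G a - bar_boundary G b"
  by (simp_all add: bar_boundary_def frag_extend_add frag_extend_diff)

lemma bar_map_add: "bar_map f (a + b) = bar_map f a + bar_map f b"
  and bar_map_diff: "bar_map f (a - b) = bar_map f a - bar_map f b"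
  by (simp_all add: bar_map_def frag_extend_add frag_extend_diff)

lemma bar_length_3:
  assumes "length xs = 3" "set xs \<subseteq> A"
  obtains g h k where "xs = [g, h, k]" "g \<in> A" "h \<in> A" "k \<in> A"
  using assms by (auto simp: numeral_3_eq_3 length_Suc_conv)

lemma bar_chain_group_simps [simp]:
  "carrier (bar_chain_group n G) =
    {c. Poly_Mapping.keys c \<subseteq> {xs. length xs = n \<and> set xs \<subseteq> carrier G}}"
  "monoid.mult (bar_chain_group n G) = (+)" "one (bar_chain_group n G) = 0"
  "comm_group (bar_chain_group n G)"
  by (simp_all add: bar_chain_group_def free_Abelian_group_def)
     (metis abelian_free_Abelian_group free_Abelian_group_def)

lemma subgroup_bar_cycles: "subgroup (bar_cycles n G) (bar_chain_group n G)"
proof -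
  interpret group "bar_chain_group n G" 
    using bar_chain_group_simps(4) by (rule comm_group.axioms)
  have *: "inv\<^bsub>bar_chain_group n G\<^esub> a = - a" if "a \<in> carrier (bar_chain_group n G)" for a
    using that by (auto intro!: inv_equality)
  have **: "bar_boundary G (- a) = - bar_boundary G a" for a
    using bar_boundary_diff[of G 0 a] by simp
  show ?thesis
  proof (rule subgroupI)
    show "bar_cycles n G \<noteq> {}"
      by (force simp: bar_cycles_def)
  next
    fix a assume "a \<in> bar_cycles n G"
    then show "inv\<^bsub>bar_chain_group n G\<^esub> a \<in> bar_cycles n G"
      by (subst *) (auto simp: bar_cycles_def **)
  next
    fix a b assume "a \<in> bar_cycles n G" "b \<in> bar_cycles n G"
    then show "a \<otimes>\<^bsub>bar_chain_group n G\<^esub> b \<in> bar_cycles n G"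
      by (simp add: bar_cycles_def bar_boundary_add order.trans[OF keys_add])
  qed (auto simp: bar_cycles_def)
qed

lemma bar_cycle_group_simps [simp]:
  "carrier (bar_cycle_group n G) = bar_cycles n G"
  "monoid.mult (bar_cycle_group n G) = (+)" "one (bar_cycle_group n G) = 0"
  "comm_group (bar_cycle_group n G)"
  using subgroup.carrier_subgroup_generated_subgroup[OF subgroup_bar_cycles]
  by (simp_all add: bar_cycle_group_def group.abelian_subgroup_generated
        comm_group.axioms)

lemma bar_boundaries_closed:
  assumes "group G"
  shows "bar_boundaries 2 G \<subseteq> bar_cycles 2 G"
proof -
  interpret group G by fact
  have "bar_boundary G c \<in> bar_cycles 2 G"
    if "Poly_Mapping.keys c \<subseteq> {xs. length xs = 3 \<and> set xs \<subseteq> carrier G}" for c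
    using that
  proof (induction c rule: frag_induction)
    case zero
    show ?case by (simp add: bar_cycles_def)
  next
    case (one xs)
    then obtain g h k where xs: "xs = [g, h, k]"
      and mem: "g \<in> carrier G" "h \<in> carrier G" "k \<in> carrier G"
      by (auto elim: bar_length_3)
    have "frag_of [a, b] \<in> carrier (bar_chain_group 2 G)"
      if "a \<in> carrier G" "b \<in> carrier G" for a b
      using that by simp
    then have "Poly_Mapping.keys (bar_boundary G (frag_of xs)) \<subseteq>
        {xs. length xs = 2 \<and> set xs \<subseteq> carrier G}"
      unfolding xs bar_boundary_3 using mem
      by (intro order.trans[OF keys_diff] order.trans[OF keys_add] Un_least) auto
    moreover have "bar_boundary G (bar_boundary G (frag_of xs)) = 0"
      using mem by (simp add: xs bar_boundary_3 bar_boundary_2 bar_boundary_add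
          bar_boundary_diff m_assoc)
    ultimately show ?case by (simp add: bar_cycles_def)
  next
    case (diff a b)
    then show ?case
      by (simp add: bar_cycles_def bar_boundary_diff order.trans[OF keys_diff])
  qed
  then show ?thesis by (auto simp: bar_boundaries_def)
qed

lemma subgroup_bar_boundaries:
  assumes "group G"
  shows "subgroup (bar_boundaries 2 G) (bar_cycle_group 2 G)"
proof -
  interpret group "bar_cycle_group 2 G"
    using bar_cycle_group_simps(4) by (rule comm_group.axioms)
  have closed: "a - b \<in> bar_boundaries 2 G"
    if ab: "a \<in> bar_boundaries 2 G" "b \<in> bar_boundaries 2 G" for a b
  proof -
    obtain c d where cd: "c \<in> carrier (bar_chain_group (Suc 2) G)"
      "d \<in> carrier (bar_chain_group (Suc 2) G)" "a = bar_boundary G c" "b = bar_boundary G d"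
      using ab by (auto simp: bar_boundaries_def)
    then have "c - d \<in> carrier (bar_chain_group (Suc 2) G)"
      by (simp add: order.trans[OF keys_diff])
    then show ?thesis
      unfolding cd(3,4) bar_boundary_diff[symmetric] bar_boundaries_def by (rule imageI)
  qed
  have zero: "0 \<in> bar_boundaries 2 G"
    unfolding bar_boundaries_def by (rule image_eqI[of _ _ 0]) auto
  have minus: "- a \<in> bar_boundaries 2 G" if "a \<in> bar_boundaries 2 G" for a
    using closed[OF zero that] by simp
  note sub = bar_boundaries_closed[OF assms]
  show ?thesis
  proof (rule subgroupI)
    fix a assume a: "a \<in> bar_boundaries 2 G"
    then have "inv\<^bsub>bar_cycle_group 2 G\<^esub> a = - a"
      using sub minus[OF a] by (intro inv_equality) auto
    then show "inv\<^bsub>bar_cycle_group 2 G\<^esub> a \<in> bar_boundaries 2 G"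
      using minus[OF a] by simp
  next
    fix a b assume "a \<in> bar_boundaries 2 G" "b \<in> bar_boundaries 2 G"
    then show "a \<otimes>\<^bsub>bar_cycle_group 2 G\<^esub> b \<in> bar_boundaries 2 G"
      using closed[of a "- b"] minus by simp
  qed (use sub zero in auto)
qed

lemma comm_group_group_homology_2:
  assumes "group G"
  shows "comm_group (group_homology 2 G)"
  unfolding group_homology_def
  by (intro comm_group.abelian_FactGroup bar_cycle_group_simps subgroup_bar_boundaries assms)

lemma bar_map_boundary:
  assumes "f \<in> hom G L" and "Poly_Mapping.keys c \<subseteq> {xs. length xs = 3 \<and> set xs \<subseteq> carrier G}"
  shows "bar_map f (bar_boundary G c) = bar_boundary L (bar_map f c)"
  using assms(2)
proof (induction c rule: frag_induction)
  case (one xs)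
  then obtain g h k where "xs = [g, h, k]"
      and "g \<in> carrier G" "h \<in> carrier G" "k \<in> carrier G"
    by (auto elim: bar_length_3)
  moreover have bar_map_of: "bar_map f (frag_of ys) = frag_of (map f ys)" for ys
    by (simp add: bar_map_def)
  ultimately show ?case using assms(1)
    by (simp add: bar_boundary_3 bar_map_add bar_map_diff hom_mult)
qed (simp_all add: bar_map_diff bar_boundary_diff, simp add: bar_map_def)

lemma group_homology_map_coset:
  assumes "group G" "group L" "f \<in> hom G L" and z: "z \<in> bar_cycles 2 G"
  shows "group_homology_map 2 L f (bar_boundaries 2 G #>\<^bsub>bar_cycle_group 2 G\<^esub> z) =
         bar_boundaries 2 L #>\<^bsub>bar_cycle_group 2 L\<^esub> bar_map f z"
proof -
  have img: "bar_map f b \<in> bar_boundaries 2 L" if b: "b \<in> bar_boundaries 2 G" for b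
  proof -
    obtain c where c: "b = bar_boundary G c"
      "Poly_Mapping.keys c \<subseteq> {xs. length xs = 3 \<and> set xs \<subseteq> carrier G}"
      using b by (auto simp: bar_boundaries_def)
    have "Poly_Mapping.keys (bar_map f c) \<subseteq> {xs. length xs = 3 \<and> set xs \<subseteq> carrier L}"
      unfolding bar_map_def
      by (rule order.trans[OF keys_frag_extend])
         (use c(2) assms(3) in \<open>force simp: hom_def Pi_iff\<close>)
    then show ?thesis
      using bar_map_boundary[OF assms(3) c(2)] c(1) by (auto simp: bar_boundaries_def)
  qed
  interpret L: subgroup "bar_boundaries 2 L" "bar_cycle_group 2 L"
    by (rule subgroup_bar_boundaries[OF assms(2)])
  interpret G: subgroup "bar_boundaries 2 G" "bar_cycle_group 2 G"
    by (rule subgroup_bar_boundaries[OF assms(1)])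
  show ?thesis (is "?L = ?R")
  proof
    show "?L \<subseteq> ?R"
    proof
      fix x assume "x \<in> ?L"
      then obtain b c where bc: "b \<in> bar_boundaries 2 L" "c \<in> bar_boundaries 2 G"
          "x = b + bar_map f (c + z)"
        by (auto simp: group_homology_map_def set_mult_def r_coset_def)
      then have "x = (b + bar_map f c) + bar_map f z" by (simp add: bar_map_add)
      moreover have "b + bar_map f c \<in> bar_boundaries 2 L"
        using L.m_closed[OF bc(1) img[OF bc(2)]] by simp
      ultimately show "x \<in> ?R" by (auto simp: r_coset_def)
    qed
    show "?R \<subseteq> ?L"
      using G.one_closed by (force simp: group_homology_map_def set_mult_def r_coset_def)
  qed
qed

end

theory Submission
  imports Defs
begin

text \<open>
  The bar complex of a finite group \<open>H\<close> satisfies \<open>\<partial> (\<Sum>k. [k|g|h]) = |H| [g|h] - t (\<partial> [g|h])\<close> with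
  \<open>t [x] = \<Sum>k. [k|x]\<close>, so \<open>|H|\<close> annihilates \<open>H\<^sub>2(H, \<int>)\<close>.  Two cycles that agree coefficientwise
  modulo \<open>|H|\<close> differ by \<open>|H|\<close> times a cycle, so each \<open>H\<^sub>2(H, \<int>)\<close> is finite.  Conjugation by an element
  of \<open>G\<close> is chain homotopic to the identity on the bar complex of \<open>G\<close>, so conjugate subgroups have the
  same image in \<open>H\<^sub>2(G, \<int>)\<close>.  Hence \<open>M\<^sub>F G\<close> is a sum of finitely many finite subgroups.
\<close>

section \<open>Linearity, naturality and change of carrier in the bar complex\<close>

lemma bar_length_2:
  assumes "length xs = 2" "set xs \<subseteq> A"
  obtains g h where "xs = [g, h]" "g \<in> A" "h \<in> A"
  using assms by (auto simp: numeral_2_eq_2 length_Suc_conv)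

lemma bar_boundary_sum: "bar_boundary G (sum f I) = (\<Sum>i\<in>I. bar_boundary G (f i))"
  by (induction I rule: infinite_finite_induct) (auto simp: bar_boundary_add)

lemma bar_boundary_cmul: "bar_boundary G (frag_cmul n c) = frag_cmul n (bar_boundary G c)"
  by (simp add: bar_boundary_def frag_extend_cmul)

lemma bar_map_of [simp]: "bar_map f (frag_of xs) = frag_of (map f xs)"
  by (simp add: bar_map_def)

lemma bar_map_id [simp]: "bar_map id c = c"
  by (simp add: bar_map_def frag_expansion[symmetric])

text \<open>The faces use only the multiplication, so one boundary operator serves \<open>G\<close>
  and all its subgroups.\<close>

lemma bar_boundary_carrier_update [simp]: "bar_boundary (G\<lparr>carrier := H\<rparr>) = bar_boundary G"
  proof -
  have "bar_face (G\<lparr>carrier := H\<rparr>) = bar_face G"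
    by (simp add: bar_face_def fun_eq_iff)
  then show ?thesis by (simp only: bar_boundary_def cong: if_cong)
qed

lemma bar_cycles_carrier_update:
  assumes "H \<subseteq> carrier G"
  shows "bar_cycles n (G\<lparr>carrier := H\<rparr>) \<subseteq> bar_cycles n G"
  using assms by (auto simp: bar_cycles_def)

lemma bar_boundaries_carrier_update:
  assumes "H \<subseteq> carrier G"
  shows "bar_boundaries n (G\<lparr>carrier := H\<rparr>) \<subseteq> bar_boundaries n G"
proof -
  have "carrier (bar_chain_group (Suc n) (G\<lparr>carrier := H\<rparr>)) \<subseteq> carrier (bar_chain_group (Suc n) G)"
    using assms by auto
  then show ?thesis by (auto simp: bar_boundaries_def simp del: bar_chain_group_simps)
qed

text \<open>Degree 2 counterpart of \<open>bar_map_boundary\<close>: that lemma transports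
  boundaries, this one lets cycles be transported.\<close>

lemma bar_map_boundary_2:
  assumes "f \<in> hom G L" and "Poly_Mapping.keys c \<subseteq> {xs. length xs = 2 \<and> set xs \<subseteq> carrier G}"
  shows "bar_map f (bar_boundary G c) = bar_boundary L (bar_map f c)"
  using assms(2)
proof (induction c rule: frag_induction)
  case (one xs)
  then obtain g h where "xs = [g, h]" "g \<in> carrier G" "h \<in> carrier G"
    by (auto elim: bar_length_2)
  then show ?case using assms(1)
    by (simp add: bar_boundary_2 bar_map_add bar_map_diff hom_mult)
qed (simp_all add: bar_map_diff bar_boundary_diff, simp add: bar_map_def)

lemma bar_map_cycles:
  assumes "f \<in> hom G L" "z \<in> bar_cycles 2 G"
  shows "bar_map f z \<in> bar_cycles 2 L"
proof -
  have z: "Poly_Mapping.keys z \<subseteq> {xs. length xs = 2 \<and> set xs \<subseteq> carrier G}" "bar_boundary G z = 0"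
    using assms(2) by (auto simp: bar_cycles_def)
  have "Poly_Mapping.keys (bar_map f z) \<subseteq> {xs. length xs = 2 \<and> set xs \<subseteq> carrier L}"
    unfolding bar_map_def
    by (rule order.trans[OF keys_frag_extend])
       (use z(1) assms(1) in \<open>force simp: hom_def Pi_iff\<close>)
  moreover have "bar_boundary L (bar_map f z) = 0"
    using bar_map_boundary_2[OF assms(1) z(1)] z(2) by (simp add: bar_map_def)
  ultimately show ?thesis by (simp add: bar_cycles_def)
qed

section \<open>The order of a finite group annihilates its second homology\<close>

lemma (in group) order_cmul_bar_cycle:
  assumes fin: "finite (carrier G)" and z: "z \<in> bar_cycles 2 G"
  shows "frag_cmul (int (order G)) z \<in> bar_boundaries 2 G"
proof -
  \<comment> \<open>A single operator for both degrees: on 1-tuples it is \<open>t\<close>, on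
    2-tuples it gives the 3-chain to be bounded.\<close>
  define s where "s = frag_extend (\<lambda>xs. \<Sum>k\<in>carrier G. frag_of (k # xs))"
  have zk: "Poly_Mapping.keys z \<subseteq> {xs. length xs = 2 \<and> set xs \<subseteq> carrier G}" "bar_boundary G z = 0"
    using z by (auto simp: bar_cycles_def)
  have const: "(\<Sum>k\<in>carrier G. c) = frag_cmul (int (order G)) c" for c :: "'a list \<Rightarrow>\<^sub>0 int"
    by (rule poly_mapping_eqI) (simp add: lookup_sum order_def)
  \<comment> \<open>Right translation permutes the group, so the face multiplying \<open>k\<close>
    by \<open>g\<close> contributes a sum that does not depend on \<open>g\<close>.\<close>
  have shift: "(\<Sum>k\<in>carrier G. f (k \<otimes> g)) = (\<Sum>k\<in>carrier G. f k)" if "g \<in> carrier G"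
    for f :: "'a \<Rightarrow> ('a list \<Rightarrow>\<^sub>0 int)" and g
    by (rule sum.reindex_bij_witness[of _ "\<lambda>k. k \<otimes> inv g" "\<lambda>k. k \<otimes> g"])
       (use that in \<open>auto simp: m_assoc\<close>)
  \<comment> \<open>The support bound goes through the same induction, since a boundary must come
    from a 3-chain over \<open>carrier G\<close>.\<close>
  have "bar_boundary G (s z) = frag_cmul (int (order G)) z - s (bar_boundary G z) \<and>
      Poly_Mapping.keys (s z) \<subseteq> {xs. length xs = 3 \<and> set xs \<subseteq> carrier G}"
    using zk(1)
  proof (induction z rule: frag_induction)
    case zero
    show ?case by (simp add: s_def)
  next
    case (one xs)
    then obtain g h where gh: "xs = [g, h]" "g \<in> carrier G" "h \<in> carrier G"
      by (auto elim: bar_length_2)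
    have "bar_boundary G (s (frag_of xs)) =
        (\<Sum>k\<in>carrier G. frag_of [g, h] - frag_of [k \<otimes> g, h] + frag_of [k, g \<otimes> h] - frag_of [k, g])"
      by (simp add: s_def gh bar_boundary_sum bar_boundary_3)
    also have "\<dots> = frag_cmul (int (order G)) (frag_of [g, h]) - (\<Sum>k\<in>carrier G. frag_of [k, h])
        + (\<Sum>k\<in>carrier G. frag_of [k, g \<otimes> h]) - (\<Sum>k\<in>carrier G. frag_of [k, g])"
      using shift[OF gh(2), of "\<lambda>k. frag_of [k, h]"]
      by (simp add: sum.distrib sum_subtractf const)
    also have "\<dots> = frag_cmul (int (order G)) (frag_of xs) - s (bar_boundary G (frag_of xs))"
      by (simp add: s_def gh bar_boundary_2 frag_extend_add frag_extend_diff)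
    finally show ?case
      using gh by (auto simp: s_def intro!: order.trans[OF keys_sum])
  next
    case (diff a b)
    then show ?case
      using keys_diff[of "s a" "s b"]
      by (auto simp: s_def frag_extend_diff bar_boundary_diff) 
         (simp_all add: poly_mapping_eq_iff fun_eq_iff lookup_minus lookup_frag_cmul algebra_simps)
  qed
  moreover have "s 0 = 0" by (simp add: s_def)
  ultimately have "frag_cmul (int (order G)) z = bar_boundary G (s z)"
      "s z \<in> carrier (bar_chain_group (Suc 2) G)"
    using zk(2) by auto
  then show ?thesis unfolding bar_boundaries_def by blast
qed

section \<open>Inner automorphisms act trivially on homology\<close>

lemma (in group) conj_mult:
  assumes "g \<in> carrier G" "x \<in> carrier G" "y \<in> carrier G"
  shows "g \<otimes> (x \<otimes> y) \<otimes> inv g = (g \<otimes> x \<otimes> inv g) \<otimes> (g \<otimes> y \<otimes> inv g)"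
proof -
  have "inv g \<otimes> (g \<otimes> (y \<otimes> inv g)) = y \<otimes> inv g"
    using assms by (simp add: m_assoc[symmetric])
  then show ?thesis using assms by (simp add: m_assoc)
qed

lemma (in group) bar_map_conj_homologous:
  assumes g: "g \<in> carrier G" and z: "z \<in> bar_cycles 2 G"
  shows "bar_map (\<lambda>x. g \<otimes> x \<otimes> inv g) z - z \<in> bar_boundaries 2 G"
proof -
  define c where "c = (\<lambda>x. g \<otimes> x \<otimes> inv g)"
  \<comment> \<open>Prism operators: \<open>inv g\<close> is inserted at every position, with
    alternating signs, and the entries to its right are conjugated. The sign of \<open>s1\<close> is
    opposite to that of \<open>s2\<close>, so that \<open>s1\<close> of the boundary enters with a
    plus.\<close>
  define s1 where "s1 = frag_extend (\<lambda>xs. frag_of [hd xs, inv g] - frag_of [inv g, c (hd xs)])"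
  define s2 where "s2 = frag_extend (\<lambda>xs. frag_of [inv g, c (xs ! 0), c (xs ! 1)]
    - frag_of [xs ! 0, inv g, c (xs ! 1)] + frag_of [xs ! 0, xs ! 1, inv g])"
  have zk: "Poly_Mapping.keys z \<subseteq> {xs. length xs = 2 \<and> set xs \<subseteq> carrier G}" "bar_boundary G z = 0"
    using z by (auto simp: bar_cycles_def)
  have c_closed: "c x \<in> carrier G" if "x \<in> carrier G" for x
    using that g by (simp add: c_def)
  have c_mult: "c (x \<otimes> y) = c x \<otimes> c y" if "x \<in> carrier G" "y \<in> carrier G" for x y
    using that g by (simp add: c_def conj_mult)
  \<comment> \<open>This relation cancels the faces in which \<open>inv g\<close> is multiplied with
    a neighbour in two adjacent prism terms.\<close>
  have c_comm: "inv g \<otimes> c x = x \<otimes> inv g" if "x \<in> carrier G" for x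
    using that g by (simp add: c_def m_assoc[symmetric])
  have "bar_boundary G (s2 z) = bar_map c z - z + s1 (bar_boundary G z) \<and>
      Poly_Mapping.keys (s2 z) \<subseteq> {xs. length xs = 3 \<and> set xs \<subseteq> carrier G}"
    using zk(1)
  proof (induction z rule: frag_induction)
    case zero
    show ?case by (simp add: s1_def s2_def bar_map_def)
  next
    case (one xs)
    then obtain a b where ab: "xs = [a, b]" "a \<in> carrier G" "b \<in> carrier G"
      by (auto elim: bar_length_2)
    have "Poly_Mapping.keys (s2 (frag_of xs)) \<subseteq> {xs. length xs = 3 \<and> set xs \<subseteq> carrier G}"
      unfolding s2_def frag_extend_of using ab g c_closed
      by (intro order.trans[OF keys_add] order.trans[OF keys_diff] Un_least) auto
    moreover have "bar_boundary G (s2 (frag_of xs)) =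
        bar_map c (frag_of xs) - frag_of xs + s1 (bar_boundary G (frag_of xs))"
      using ab by (simp add: s1_def s2_def bar_boundary_3 bar_boundary_2 bar_boundary_add
          bar_boundary_diff frag_extend_add frag_extend_diff c_comm c_mult)
    ultimately show ?case by blast
  next
    case (diff a b)
    then show ?case
      using keys_diff[of "s2 a" "s2 b"]
      by (auto simp: s1_def s2_def frag_extend_diff bar_boundary_diff bar_map_diff)
  qed
  moreover have "s1 0 = 0" by (simp add: s1_def)
  ultimately have "bar_map c z - z = bar_boundary G (s2 z)"
      "s2 z \<in> carrier (bar_chain_group (Suc 2) G)"
    using zk(2) by auto
  then show ?thesis unfolding bar_boundaries_def c_def by blast
qed

section \<open>Images of finite subgroups in homology are finite subgroups\<close>

lemma (in group) bar_coset_eqI: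
  assumes "w \<in> bar_cycles 2 G" "z \<in> bar_cycles 2 G" "z - w \<in> bar_boundaries 2 G"
  shows "bar_boundaries 2 G #>\<^bsub>bar_cycle_group 2 G\<^esub> w =
    bar_boundaries 2 G #>\<^bsub>bar_cycle_group 2 G\<^esub> z"
proof -
  interpret Z: comm_group "bar_cycle_group 2 G" by simp
  show ?thesis
  proof (rule Z.repr_independence)
    show "z \<in> bar_boundaries 2 G #>\<^bsub>bar_cycle_group 2 G\<^esub> w"
      unfolding r_coset_def using assms(3) by (auto intro: bexI[of _ "z - w"])
  qed (use assms subgroup_bar_boundaries group_axioms in auto)
qed

text \<open>The inclusion is the identity on chains, so a class of \<open>H\<close> only has its
  coset enlarged by the boundaries of \<open>G\<close>. From here on one can argue with
  cycles.\<close>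

lemma (in group) H2_image_eq:
  assumes "subgroup H G"
  shows "H2_image G H =
    (\<lambda>z. bar_boundaries 2 G #>\<^bsub>bar_cycle_group 2 G\<^esub> z) ` bar_cycles 2 (G\<lparr>carrier := H\<rparr>)"
proof -
  have "id \<in> hom (G\<lparr>carrier := H\<rparr>) G"
    using subgroup.subset[OF assms] by (auto simp: hom_def)
  then show ?thesis
    using group_homology_map_coset[OF subgroup_imp_group[OF assms] group_axioms]
    by (auto simp: H2_image_def group_homology_def FactGroup_def RCOSETS_def image_iff)
qed

lemma (in group) subgroup_H2_image:
  assumes "subgroup H G"
  shows "subgroup (H2_image G H) (group_homology 2 G)"
proof -
  interpret Z: comm_group "bar_cycle_group 2 G" by simp
  interpret Q: comm_group "group_homology 2 G"
    by (rule comm_group_group_homology_2) (rule group_axioms)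
  interpret N: normal "bar_boundaries 2 G" "bar_cycle_group 2 G"
    by (rule Z.subgroup_imp_normal[OF subgroup_bar_boundaries]) (rule group_axioms)
  interpret h: group_hom "bar_cycle_group 2 G" "group_homology 2 G"
      "\<lambda>z. bar_boundaries 2 G #>\<^bsub>bar_cycle_group 2 G\<^esub> z"
    by unfold_locales (simp add: group_homology_def N.r_coset_hom_Mod)
  interpret S: comm_group "bar_cycle_group 2 (G\<lparr>carrier := H\<rparr>)" by simp
  have sub: "bar_cycles 2 (G\<lparr>carrier := H\<rparr>) \<subseteq> bar_cycles 2 G"
    by (rule bar_cycles_carrier_update) (rule subgroup.subset[OF assms])
  have "subgroup (bar_cycles 2 (G\<lparr>carrier := H\<rparr>)) (bar_cycle_group 2 G)"
  proof (rule Z.subgroupI)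
    fix a assume a: "a \<in> bar_cycles 2 (G\<lparr>carrier := H\<rparr>)"
    \<comment> \<open>The inverse is formed among the cycles of \<open>H\<close>; both cycle groups
      share their addition, so it is also the inverse in the larger one.\<close>
    let ?b = "inv\<^bsub>bar_cycle_group 2 (G\<lparr>carrier := H\<rparr>)\<^esub> a"
    have b: "?b \<in> bar_cycles 2 (G\<lparr>carrier := H\<rparr>)" and "?b + a = 0"
      using S.inv_closed[of a] S.l_inv[of a] a by simp_all
    then show "inv\<^bsub>bar_cycle_group 2 G\<^esub> a \<in> bar_cycles 2 (G\<lparr>carrier := H\<rparr>)"
      using Z.inv_equality[of ?b a] a subsetD[OF sub] by simp
  qed (use sub S.one_closed S.m_closed in auto)
  then show ?thesis
    unfolding H2_image_eq[OF assms] by (rule h.subgroup_img_is_subgroup)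
qed

text \<open>Choosing a preimage under \<open>r\<close> exhibits the values of \<open>f\<close> as an
  image of a finite set. In the application \<open>r\<close> reduces coefficients modulo the group
  order.\<close>

lemma finite_image_if_factors:
  assumes "finite (r ` Z)" and "\<And>x y. x \<in> Z \<Longrightarrow> y \<in> Z \<Longrightarrow> r x = r y \<Longrightarrow> f x = f y"
  shows "finite (f ` Z)"
proof -
  have "f x = f (inv_into Z r (r x))" if "x \<in> Z" for x
    using that by (intro assms(2)) (auto simp: inv_into_into f_inv_into_f)
  then have "f ` Z \<subseteq> (\<lambda>t. f (inv_into Z r t)) ` r ` Z" by auto
  then show ?thesis using assms(1) by (meson finite_imageI finite_subset)
qed

lemma (in group) finite_H2_image:
  assumes "subgroup H G" "finite H"
  shows "finite (H2_image G H)"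
  unfolding H2_image_eq[OF assms(1)]
proof (rule finite_image_if_factors)
  interpret H: group "G\<lparr>carrier := H\<rparr>" by (rule subgroup_imp_group[OF assms(1)])
  define N where "N = int (order (G\<lparr>carrier := H\<rparr>))"
  define r where "r = (\<lambda>(z :: 'a list \<Rightarrow>\<^sub>0 int) xs. Poly_Mapping.lookup z xs mod N)"
  note sub = subgroup.subset[OF assms(1)]
  have N: "N > 0"
    using H.order_gt_0_iff_finite assms(2) by (simp add: N_def)
  \<comment> \<open>There are finitely many pairs over \<open>H\<close>; a reduced coefficient takes
    \<open>N\<close> values on them and is 0 elsewhere.\<close>
  let ?S = "{xs. set xs \<subseteq> H \<and> length xs = 2}"
  have "r ` bar_cycles 2 (G\<lparr>carrier := H\<rparr>) \<subseteq>
      {f. \<forall>xs. (xs \<in> ?S \<longrightarrow> f xs \<in> {0..<N}) \<and> (xs \<notin> ?S \<longrightarrow> f xs = 0)}"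
    using N unfolding r_def bar_cycles_def
    by (auto simp: subset_iff) (metis in_keys_iff mod_0)+
  moreover have "finite \<dots>"
    by (intro finite_set_of_finite_funs finite_lists_length_eq assms(2)) simp
  ultimately show "finite (r ` bar_cycles 2 (G\<lparr>carrier := H\<rparr>))"
    by (rule finite_subset)
  fix z w assume zw: "z \<in> bar_cycles 2 (G\<lparr>carrier := H\<rparr>)" "w \<in> bar_cycles 2 (G\<lparr>carrier := H\<rparr>)"
    "r z = r w"
  \<comment> \<open>The exact quotient of the difference by \<open>N\<close>. As
    \<open>0 div N = 0\<close>, division does not enlarge the support.\<close>
  define q where "q = Poly_Mapping.map (\<lambda>n. n div N) (w - z)"
  have lookup_q: "Poly_Mapping.lookup q xs = Poly_Mapping.lookup (w - z) xs div N" for xs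
    by (simp add: q_def map.rep_eq when_def)
  have "N dvd Poly_Mapping.lookup (w - z) xs" for xs
    using fun_cong[OF zw(3), of xs] by (simp add: r_def lookup_minus mod_eq_dvd_iff dvd_diff_commute)
  then have q: "w - z = frag_cmul N q"
    by (intro poly_mapping_eqI) (simp add: lookup_q)
  have "Poly_Mapping.keys q \<subseteq> Poly_Mapping.keys (w - z)"
    by (auto simp: in_keys_iff lookup_q)
  then have "Poly_Mapping.keys q \<subseteq> {xs. length xs = 2 \<and> set xs \<subseteq> H}"
    using zw(1,2) keys_diff[of w z] by (simp add: bar_cycles_def) blast
  \<comment> \<open>Chains are torsion free and \<open>N > 0\<close>, so \<open>q\<close> itself is
    a cycle, and the annihilation result makes its multiple by \<open>N\<close> a boundary.\<close>
  moreover have "frag_cmul N (bar_boundary G q) = 0"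
    using zw by (simp add: bar_boundary_cmul[symmetric] q[symmetric] bar_boundary_diff bar_cycles_def)
  ultimately have "q \<in> bar_cycles 2 (G\<lparr>carrier := H\<rparr>)"
    using N by (simp add: bar_cycles_def)
  then have "w - z \<in> bar_boundaries 2 (G\<lparr>carrier := H\<rparr>)"
    unfolding q N_def using assms(2) by (intro H.order_cmul_bar_cycle) auto
  then show "bar_boundaries 2 G #>\<^bsub>bar_cycle_group 2 G\<^esub> z =
      bar_boundaries 2 G #>\<^bsub>bar_cycle_group 2 G\<^esub> w"
    using zw bar_cycles_carrier_update[OF sub] bar_boundaries_carrier_update[OF sub]
    by (intro bar_coset_eqI) auto
qed

section \<open>Conjugate subgroups have the same image\<close>

lemma (in group) conj_set_eq:
  assumes "H \<subseteq> carrier G" "g \<in> carrier G"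
  shows "g <# H #> inv g = (\<lambda>x. g \<otimes> x \<otimes> inv g) ` H"
  by (auto simp: l_coset_def r_coset_def)

lemma (in group) subgroup_conj:
  assumes "subgroup H G" "g \<in> carrier G"
  shows "subgroup (g <# H #> inv g) G"
proof -
  interpret subgroup H G by fact
  interpret c: group_hom G G "\<lambda>x. g \<otimes> x \<otimes> inv g"
    by unfold_locales (use assms(2) in \<open>auto simp: hom_def conj_mult\<close>)
  show ?thesis
    using c.subgroup_img_is_subgroup[OF assms(1)] conj_set_eq[OF subset assms(2)] by simp
qed

text \<open>A cycle of \<open>H\<close> is homologous in \<open>G\<close> to its conjugate, which is
  a cycle of the conjugate subgroup.\<close>

lemma (in group) H2_image_conj_subset:
  assumes "subgroup H G" "g \<in> carrier G"
  shows "H2_image G H \<subseteq> H2_image G (g <# H #> inv g)"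
proof -
  interpret subgroup H G by fact
  let ?c = "\<lambda>x. g \<otimes> x \<otimes> inv g" and ?K = "g <# H #> inv g"
  have hom: "?c \<in> hom (G\<lparr>carrier := H\<rparr>) (G\<lparr>carrier := ?K\<rparr>)"
    using assms(2) by (auto simp: hom_def conj_set_eq[OF subset assms(2)] conj_mult)
  have K: "subgroup ?K G" by (rule subgroup_conj[OF assms])
  show ?thesis
    unfolding H2_image_eq[OF assms(1)] H2_image_eq[OF K]
  proof (rule image_subsetI)
    fix z assume z: "z \<in> bar_cycles 2 (G\<lparr>carrier := H\<rparr>)"
    then have cz: "bar_map ?c z \<in> bar_cycles 2 (G\<lparr>carrier := ?K\<rparr>)"
      by (rule bar_map_cycles[OF hom])
    have "z \<in> bar_cycles 2 G" "bar_map ?c z \<in> bar_cycles 2 G"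
      using z cz bar_cycles_carrier_update subset subgroup.subset[OF K] by blast+
    then have "bar_boundaries 2 G #>\<^bsub>bar_cycle_group 2 G\<^esub> z =
        bar_boundaries 2 G #>\<^bsub>bar_cycle_group 2 G\<^esub> bar_map ?c z"
      using assms(2) by (intro bar_coset_eqI bar_map_conj_homologous)
    then show "bar_boundaries 2 G #>\<^bsub>bar_cycle_group 2 G\<^esub> z \<in>
        (\<lambda>z. bar_boundaries 2 G #>\<^bsub>bar_cycle_group 2 G\<^esub> z) ` bar_cycles 2 (G\<lparr>carrier := ?K\<rparr>)"
      using cz by blast
  qed
qed

lemma (in group) H2_image_conj:
  assumes "subgroup H G" "g \<in> carrier G"
  shows "H2_image G (g <# H #> inv g) = H2_image G H"
proof
  note sub = subgroup.subset[OF assms(1)]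
  have K: "subgroup (g <# H #> inv g) G" by (rule subgroup_conj[OF assms])
  \<comment> \<open>Conjugating back by \<open>inv g\<close> recovers \<open>H\<close>, so the
    reverse inclusion is the previous lemma for the conjugate subgroup.\<close>
  have "inv g \<otimes> (g \<otimes> x \<otimes> inv g) \<otimes> g = x" if "x \<in> H" for x
  proof -
    have "x \<in> carrier G" using that sub by blast
    then show ?thesis using assms(2) by (simp add: m_assoc inv_solve_left')
  qed
  then have "inv g <# (g <# H #> inv g) #> inv (inv g) = H"
    using assms(2) sub conj_set_eq[OF sub assms(2)]
      conj_set_eq[OF subgroup.subset[OF K] inv_closed[OF assms(2)]]
    by (auto simp: image_image)
  then show "H2_image G (g <# H #> inv g) \<subseteq> H2_image G H"
    using H2_image_conj_subset[OF K inv_closed[OF assms(2)]] by simp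
qed (rule H2_image_conj_subset[OF assms])

section \<open>Finiteness of \<open>M\<^sub>F G\<close> and of its quotient\<close>

lemma (in group) finite_H2_images:
  assumes "finite (finite_subgroup_conjugacy_classes G)"
  shows "finite (H2_image G ` finite_subgroups G)"
proof -
  \<comment> \<open>The image is constant on a conjugacy class, so any chosen member determines it
    and the images are indexed by the classes.\<close>
  have "H2_image G H \<in> (\<lambda>C. H2_image G (SOME K. K \<in> C)) ` finite_subgroup_conjugacy_classes G"
    if "H \<in> finite_subgroups G" for H
  proof -
    let ?C = "orbit G (\<lambda>g H. g <# H #> inv g) H"
    have H: "subgroup H G" using that by (simp add: finite_subgroups_def)
    \<comment> \<open>A witness that the orbit is nonempty, as the choice of a member
      requires.\<close>
    have "\<one> <# H #> inv \<one> \<in> ?C" unfolding orbit_def by blast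
    then have "(SOME K. K \<in> ?C) \<in> ?C" by (rule someI)
    then have "H2_image G (SOME K. K \<in> ?C) = H2_image G H"
      unfolding orbit_def using H2_image_conj[OF H] by auto
    moreover have "?C \<in> finite_subgroup_conjugacy_classes G"
      using that by (auto simp: finite_subgroup_conjugacy_classes_def orbits_def)
    ultimately show ?thesis by (intro image_eqI) auto
  qed
  then show ?thesis
    using assms by (meson finite_imageI finite_subset image_subsetI)
qed

text \<open>In an abelian group the product set of two finite subgroups is again a finite subgroup
  and contains both. Induction thus gives a finite subgroup around the union, hence around what it
  generates.\<close>

lemma (in comm_group) finite_generate_Union_subgroups:
  assumes "finite S" "\<And>H. H \<in> S \<Longrightarrow> subgroup H G \<and> finite H"
  shows "finite (generate G (\<Union>S))"
proof -
  have "\<exists>K. subgroup K G \<and> finite K \<and> \<Union>S \<subseteq> K"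
    using assms
  proof (induction S rule: finite_induct)
    case empty
    then show ?case using triv_subgroup by auto
  next
    case (insert H S)
    then obtain K where K: "subgroup K G" "finite K" "\<Union>S \<subseteq> K" by auto
    have H: "subgroup H G" "finite H" using insert.prems by auto
    interpret H: subgroup H G by (rule H)
    interpret K: subgroup K G by (rule K)
    have "finite (H <#> K)"
      using H(2) K(2) by (simp add: set_mult_def)
    moreover have "h \<in> H <#> K" if "h \<in> H" for h
      using set_mult_def[of G H K] that K.one_closed r_one[OF H.mem_carrier[OF that]]
      by (metis (mono_tags, lifting) UN_iff singletonI)
    moreover have "k \<in> H <#> K" if "k \<in> K" for k
      using set_mult_def[of G H K] that H.one_closed l_one[OF K.mem_carrier[OF that]]
      by (metis (mono_tags, lifting) UN_iff singletonI)
    ultimately show ?case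
      using mult_subgroups[OF H(1) K(1)] K(3) by (intro exI[of _ "H <#> K"]) auto
  qed
  then show ?thesis
    by (meson finite_subset generate_subgroup_incl)
qed

theorem proposition8p3:
  fixes G :: "('a, 'b) monoid_scheme" (structure)
  assumes "group G"
    and "finite (finite_subgroup_conjugacy_classes G)"
  shows "comm_group (finitary_Bogomolov_multiplier G) \<and>
         finite (carrier (finitary_Bogomolov_multiplier G))"
proof -
  interpret group G by fact
  interpret Q: comm_group "group_homology 2 G"
    by (rule comm_group_group_homology_2) fact
  have img: "subgroup (H2_image G H) (group_homology 2 G)" "finite (H2_image G H)"
    if "H \<in> finite_subgroups G" for H
    using that subgroup_H2_image finite_H2_image by (auto simp: finite_subgroups_def)
  have carr: "(\<Union>H\<in>finite_subgroups G. H2_image G H) \<subseteq> carrier (group_homology 2 G)"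
    using img(1)[THEN subgroup.subset] by blast
  have abel: "(\<Union>A\<in>finite_abelian_subgroups G. H2_image G A) \<subseteq>
      (\<Union>H\<in>finite_subgroups G. H2_image G H)"
    by (auto simp: finite_abelian_subgroups_def)
  have MF: "subgroup (M\<^sub>F G) (group_homology 2 G)"
    unfolding M\<^sub>F_def using carr by (rule Q.generate_is_subgroup)
  have M0F: "subgroup (M\<^sub>0\<^sub>F G) (group_homology 2 G)"
    unfolding M\<^sub>0\<^sub>F_def using abel carr by (intro Q.generate_is_subgroup) blast
  \<comment> \<open>Finite abelian subgroups are among the finite ones, so the quotient is by a
    genuine subgroup.\<close>
  have "M\<^sub>0\<^sub>F G \<subseteq> M\<^sub>F G"
    unfolding M\<^sub>F_def M\<^sub>0\<^sub>F_def using abel by (rule Q.mono_generate)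
  then have sub: "subgroup (M\<^sub>0\<^sub>F G) ((group_homology 2 G)\<lparr>carrier := M\<^sub>F G\<rparr>)"
    by (intro Q.subgroup_incl M0F MF)
  have "finite (M\<^sub>F G)"
    unfolding M\<^sub>F_def
    by (rule Q.finite_generate_Union_subgroups[OF finite_H2_images[OF assms(2)]]) (use img in auto)
  \<comment> \<open>The cosets are indexed by the elements of the finite group
    \<open>M\<^sub>F G\<close>.\<close>
  then have "finite (carrier (finitary_Bogomolov_multiplier G))"
    by (simp add: finitary_Bogomolov_multiplier_def FactGroup_def RCOSETS_def)
  moreover have "comm_group ((group_homology 2 G)\<lparr>carrier := M\<^sub>F G\<rparr>)"
    using Q.subgroup_imp_group[OF MF] Q.m_comm subgroup.subset[OF MF]
    by (intro group.group_comm_groupI) auto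
  ultimately show ?thesis
    using comm_group.abelian_FactGroup[OF _ sub] by (simp add: finitary_Bogomolov_multiplier_def)
qed

end
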